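(* Let $\digamma$ be (the set-valued map of) a holomorphic correspondence on $\widehat{\mathbb{C}}$ and let $\mu \in \mathscr{M}(\widehat{\mathbb{C}})$ be an ergodic measure with respect to $\digamma$ such that $\mu(B) > 0$ for any non-empty open set $B \subseteq \widehat{\mathbb{C}}$. Then, for $\mu$-almost every point $z\in\widehat{\mathbb{C}}$, the set of forward images $\bigcup_{i \ge 0} \digamma^{i}(z)$ is dense in $\widehat{\mathbb{C}}$.
   Context: A holomorphic correspondence on $\widehat{\mathbb{C}}$ is a formal sum $\Gamma = \sum_{\alpha=1}^{N} m_{\alpha}\Gamma_{\alpha}$, where the $m_\alpha$ are positive integers and the $\Gamma_\alpha \subseteq \widehat{\mathbb{C}}\times\widehat{\mathbb{C}}$ are distinct irreducible complex-analytic subvarieties of dimension $1$ such that, with $\pi_1,\pi_2$ the coordinate projections, each $\pi_i|_{\Gamma_\alpha}$ is surjective ($i=1,2$) and, for every $\alpha$ and any generic $z_0$, the sets $\pi_1(\pi_2^{-1}(\{z_0\})\cap\Gamma_\alpha)$ and $\pi_2(\pi_1^{-1}(\{z_0\})\cap\Gamma_\alpha)$ are finite. The support is $|\Gamma| = \bigcup_\alpha \Gamma_\alpha$. The associated set-valued map $\digamma$ is $\digamma(z)=\{w : (z,w)\in|\Gamma|\}$ and $\digamma^{\dagger}(z)=\{w : (w,z)\in|\Gamma|\}$ is the set of pre-images; images and pre-images are counted with multiplicity (in particular in sums). The topological degree $d_{\mathrm{top}}$ is the number of pre-images, counted with multiplicity, of a generic point. For sets, $\digamma(A)=\bigcup_{z\in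 A}\digamma(z)$ and $\digamma^\dagger(A)=\bigcup_{z\in A}\digamma^\dagger(z)$. For $i\ge1$, $\digamma^i(z)$ is, as a set, the $i$-fold iterate of $\digamma$ applied to $z$, and $\digamma^0(z)=\{z\}$. $\mathscr{M}(\widehat{\mathbb{C}})$ is the set of Borel probability measures on $\widehat{\mathbb{C}}$. $\mu\in\mathscr{M}(\widehat{\mathbb{C}})$ is $\digamma^{*}$-invariant if $\int f\,\mathrm{d}\mu = \frac{1}{d_{\mathrm{top}}}\int \sum_{w\in\digamma^{\dagger}(z)} f(w)\,\mathrm{d}\mu(z)$ for all $f\in\mathcal{C}(\widehat{\mathbb{C}},\mathbb{R})$. A Borel set $A\subseteq\widehat{\mathbb{C}}$ is almost invariant with respect to $(\digamma,\mu)$ if there is a Borel set $A'\subseteq A$ with $\mu(A')=\mu(A)$ and $\digamma^\dagger(A')\subseteq A$. A measure $\mu$ is ergodic with respect to $\digamma$ if it is $\digamma^*$-invariant and every Borel set almost invariant with respect to $(\digamma,\mu)$ has $\mu$-measure $0$ or $1$. *)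

theory Defs
  imports "HOL-Probability.Probability"
begin

section \<open>The Riemann sphere\<close>

datatype riemann_sphere = Fin complex | Infty

text \<open>The topology is that of the one-point compactification of the plane.\<close>

instantiation riemann_sphere :: topological_space
begin

definition open_riemann_sphere :: "riemann_sphere set \<Rightarrow> bool" where
  "open_riemann_sphere U \<longleftrightarrow>
     open (Fin -` U) \<and> (Infty \<in> U \<longrightarrow> compact (- (Fin -` U)))"

instance
proof
  show "open (UNIV :: riemann_sphere set)"
    by (simp add: open_riemann_sphere_def)
next
  fix S T :: "riemann_sphere set"
  assume "open S" "open T"
  then show "open (S \<inter> T)"
    by (auto simp: open_riemann_sphere_def Compl_Int intro: compact_Un)
next
  fix K :: "riemann_sphere set set"
  assume K: "\<forall>S\<in>K. open S"
  have op: "open (Fin -` \<Union>K)"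
    using K by (auto simp: open_riemann_sphere_def vimage_Union)
  have "compact (- (Fin -` \<Union>K))" if "Infty \<in> \<Union>K"
  proof -
    from that obtain S where S: "S \<in> K" "Infty \<in> S" by blast
    then have "compact (- (Fin -` S))"
      using K by (auto simp: open_riemann_sphere_def)
    moreover have "- (Fin -` \<Union>K) = - (Fin -` S) \<inter> - (Fin -` \<Union>K)"
      using S by blast
    ultimately show ?thesis
      using op compact_Int_closed[of "- (Fin -` S)" "- (Fin -` \<Union>K)"] by (metis closed_Compl)
  qed
  with op show "open (\<Union>K)"
    by (simp add: open_riemann_sphere_def)
qed

end

text \<open>
  The two standard holomorphic parametrisations: the plane itself and the coordinate
  \<open>w = 1/z\<close> around the point at infinity.
\<close>

definition param_infty :: "complex \<Rightarrow> riemann_sphere" where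
  "param_infty w = (if w = 0 then Infty else Fin (1 / w))"

definition sphere_atlas :: "(complex \<Rightarrow> riemann_sphere) set" where
  "sphere_atlas = {Fin, param_infty}"


section \<open>Analytic subvarieties of the product of two spheres\<close>

text \<open>Holomorphy of functions of two variables: the Frechet derivative is complex linear.\<close>

definition holomorphic2_on :: "(complex \<times> complex \<Rightarrow> complex) \<Rightarrow> (complex \<times> complex) set \<Rightarrow> bool" where
  "holomorphic2_on f U \<longleftrightarrow>
     (\<forall>p\<in>U. \<exists>a b. (f has_derivative (\<lambda>(u, v). a * u + b * v)) (at p within U))"

definition analytic_in_plane2 :: "(complex \<times> complex) set \<Rightarrow> bool" where
  "analytic_in_plane2 S \<longleftrightarrow>
     (\<forall>p. \<exists>U F. open U \<and> p \<in> U \<and> finite F \<and> (\<forall>f\<in>F. holomorphic2_on f U) \<and>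
        S \<inter> U = {q \<in> U. \<forall>f\<in>F. f q = 0})"

definition submanifold_near :: "nat \<Rightarrow> (complex \<times> complex) set \<Rightarrow> complex \<times> complex \<Rightarrow> bool" where
  "submanifold_near k S p \<longleftrightarrow>
     (\<exists>U W \<phi> \<psi>. open U \<and> open W \<and> p \<in> U \<and> homeomorphism U W \<phi> \<psi> \<and>
        holomorphic2_on (fst \<circ> \<phi>) U \<and> holomorphic2_on (snd \<circ> \<phi>) U \<and>
        holomorphic2_on (fst \<circ> \<psi>) W \<and> holomorphic2_on (snd \<circ> \<psi>) W \<and>
        S \<inter> U = {q \<in> U. (k < 1 \<longrightarrow> fst (\<phi> q) = 0) \<and> (k < 2 \<longrightarrow> snd (\<phi> q) = 0)})"

text \<open>
  Being analytic is a local condition at every point of the ambient space (so it includes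
  closedness), and the four products of parametrisations cover the product of two spheres by
  open sets; hence it may be tested in these coordinates.
\<close>

definition analytic_subset :: "(riemann_sphere \<times> riemann_sphere) set \<Rightarrow> bool" where
  "analytic_subset A \<longleftrightarrow>
     (\<forall>\<phi>\<in>sphere_atlas. \<forall>\<psi>\<in>sphere_atlas. analytic_in_plane2 (map_prod \<phi> \<psi> -` A))"

definition irreducible_analytic :: "(riemann_sphere \<times> riemann_sphere) set \<Rightarrow> bool" where
  "irreducible_analytic A \<longleftrightarrow> analytic_subset A \<and> A \<noteq> {} \<and>
     (\<forall>B C. analytic_subset B \<longrightarrow> analytic_subset C \<longrightarrow> A = B \<union> C \<longrightarrow> A = B \<or> A = C)"

text \<open>The dimension of an analytic set is the largest dimension it has at a regular point.\<close>

definition regular_point ::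
  "nat \<Rightarrow> (riemann_sphere \<times> riemann_sphere) set \<Rightarrow> riemann_sphere \<times> riemann_sphere \<Rightarrow> bool" where
  "regular_point k A x \<longleftrightarrow> x \<in> A \<and>
     (\<exists>\<phi>\<in>sphere_atlas. \<exists>\<psi>\<in>sphere_atlas. \<exists>p.
        map_prod \<phi> \<psi> p = x \<and> submanifold_near k (map_prod \<phi> \<psi> -` A) p)"

definition analytic_dim :: "(riemann_sphere \<times> riemann_sphere) set \<Rightarrow> nat" where
  "analytic_dim A = Max {k. k \<le> 2 \<and> (\<exists>x. regular_point k A x)}"


section \<open>Holomorphic correspondences\<close>

text \<open>
  The formal sum of the \<open>m\<^sub>\<alpha> \<Gamma>\<^sub>\<alpha>\<close> is the finite multiset containing each
  \<open>\<Gamma>\<^sub>\<alpha>\<close> exactly \<open>m\<^sub>\<alpha>\<close> times. A property is generic if it holds outside a proper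
  analytic subset of the sphere, that is, outside a finite set.
\<close>

type_synonym correspondence = "(riemann_sphere \<times> riemann_sphere) set multiset"

definition holomorphic_correspondence :: "correspondence \<Rightarrow> bool" where
  "holomorphic_correspondence \<Gamma> \<longleftrightarrow> \<Gamma> \<noteq> {#} \<and>
     (\<forall>A\<in>#\<Gamma>. irreducible_analytic A \<and> analytic_dim A = 1 \<and>
        fst ` A = UNIV \<and> snd ` A = UNIV \<and>
        (\<forall>\<^sub>F z in cofinite. finite (fst ` (snd -` {z} \<inter> A)) \<and> finite (snd ` (fst -` {z} \<inter> A))))"

definition support :: "correspondence \<Rightarrow> (riemann_sphere \<times> riemann_sphere) set" where
  "support \<Gamma> = \<Union>(set_mset \<Gamma>)"

definition corr_map :: "correspondence \<Rightarrow> riemann_sphere \<Rightarrow> riemann_sphere set" where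
  "corr_map \<Gamma> z = {w. (z, w) \<in> support \<Gamma>}"

definition corr_adj :: "correspondence \<Rightarrow> riemann_sphere \<Rightarrow> riemann_sphere set" where
  "corr_adj \<Gamma> z = {w. (w, z) \<in> support \<Gamma>}"

definition corr_image :: "correspondence \<Rightarrow> riemann_sphere set \<Rightarrow> riemann_sphere set" where
  "corr_image \<Gamma> A = (\<Union>z\<in>A. corr_map \<Gamma> z)"

definition corr_preimage :: "correspondence \<Rightarrow> riemann_sphere set \<Rightarrow> riemann_sphere set" where
  "corr_preimage \<Gamma> A = (\<Union>z\<in>A. corr_adj \<Gamma> z)"

definition corr_iter :: "correspondence \<Rightarrow> nat \<Rightarrow> riemann_sphere \<Rightarrow> riemann_sphere set" where
  "corr_iter \<Gamma> i z = (corr_image \<Gamma> ^^ i) {z}"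

text \<open>
  The multiplicity of \<open>w\<close> as a pre-image of \<open>z\<close> under a single curve \<open>A\<close> is the local degree
  at \<open>(w, z)\<close> of the second projection restricted to \<open>A\<close>: the number of points of \<open>A\<close> close to
  \<open>(w, z)\<close> that lie over a point close to, but different from, \<open>z\<close>. It is 0 off \<open>A\<close>.
\<close>

definition preimage_mult ::
  "(riemann_sphere \<times> riemann_sphere) set \<Rightarrow> riemann_sphere \<Rightarrow> riemann_sphere \<Rightarrow> nat" where
  "preimage_mult A w z =
     (THE n. \<exists>U\<^sub>0. open U\<^sub>0 \<and> (w, z) \<in> U\<^sub>0 \<and>
        (\<forall>U. open U \<longrightarrow> (w, z) \<in> U \<longrightarrow> U \<subseteq> U\<^sub>0 \<longrightarrow>
           (\<forall>\<^sub>F z' in at z. finite {w'. (w', z') \<in> A \<inter> U} \<and> card {w'. (w', z') \<in> A \<inter> U} = n)))"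

definition corr_preimage_mult ::
  "correspondence \<Rightarrow> riemann_sphere \<Rightarrow> riemann_sphere \<Rightarrow> nat" where
  "corr_preimage_mult \<Gamma> w z = (\<Sum>A\<in>#\<Gamma>. preimage_mult A w z)"

definition dtop :: "correspondence \<Rightarrow> nat" where
  "dtop \<Gamma> = (THE d. \<forall>\<^sub>F z in cofinite. (\<Sum>w\<in>corr_adj \<Gamma> z. corr_preimage_mult \<Gamma> w z) = d)"


section \<open>Invariant and ergodic measures\<close>

definition borel_prob_measures :: "riemann_sphere measure set" where
  "borel_prob_measures = {\<mu>. sets \<mu> = sets borel \<and> prob_space \<mu>}"

definition pullback_invariant :: "correspondence \<Rightarrow> riemann_sphere measure \<Rightarrow> bool" where
  "pullback_invariant \<Gamma> \<mu> \<longleftrightarrow>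
     (\<forall>f :: riemann_sphere \<Rightarrow> real. continuous_on UNIV f \<longrightarrow>
        (\<integral>z. f z \<partial>\<mu>) =
        1 / real (dtop \<Gamma>) *
          (\<integral>z. (\<Sum>w\<in>corr_adj \<Gamma> z. real (corr_preimage_mult \<Gamma> w z) * f w) \<partial>\<mu>))"

definition almost_invariant ::
  "correspondence \<Rightarrow> riemann_sphere measure \<Rightarrow> riemann_sphere set \<Rightarrow> bool" where
  "almost_invariant \<Gamma> \<mu> A \<longleftrightarrow> A \<in> sets borel \<and>
     (\<exists>A'\<in>sets borel. A' \<subseteq> A \<and> measure \<mu> A' = measure \<mu> A \<and> corr_preimage \<Gamma> A' \<subseteq> A)"

definition ergodic :: "correspondence \<Rightarrow> riemann_sphere measure \<Rightarrow> bool" where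
  "ergodic \<Gamma> \<mu> \<longleftrightarrow> pullback_invariant \<Gamma> \<mu> \<and>
     (\<forall>A. almost_invariant \<Gamma> \<mu> A \<longrightarrow> measure \<mu> A = 0 \<or> measure \<mu> A = 1)"

end

theory Submission
  imports Defs
begin

text \<open>
  For a closed disc \<open>K\<close>, the set of points whose forward orbit meets \<open>K\<close> contains all its own
  pre-images, hence is almost invariant once it is known to be Borel; it contains \<open>K\<close>, which
  has positive measure, so by ergodicity it has full measure. Countably many such discs suffice
  to test density. The set is Borel since it is the union of the iterated pre-images of \<open>K\<close>, which
  are closed: the support of a correspondence is closed and the sphere is compact.
\<close>

section \<open>Topology of the sphere\<close>

lemma open_Fin_image: "open U \<Longrightarrow> open (Fin ` U)"
  by (auto simp: open_riemann_sphere_def inj_vimage_image_eq inj_def)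

lemma closed_Fin_image:
  assumes "compact K"
  shows "closed (Fin ` K)"
proof -
  have "Fin -` (- Fin ` K) = - K" by auto
  then show ?thesis
    using assms compact_imp_closed[OF assms]
    by (simp add: closed_def[of "Fin ` K"] open_riemann_sphere_def open_Compl)
qed

text \<open>\<open>Infty\<close> is not isolated: if \<open>{Infty}\<close> were open, the whole
  plane would be compact. Hence discs in the plane suffice to test density on the sphere.\<close>

lemma open_nonempty_imp_Fin_vimage_nonempty:
  assumes "open U" "U \<noteq> {}"
  shows "Fin -` U \<noteq> {}"
proof
  assume *: "Fin -` U = {}"
  obtain x where "x \<in> U" using assms by blast
  with * have "Infty \<in> U" by (cases x) auto
  with assms * have "compact (UNIV :: complex set)"
    by (auto simp: open_riemann_sphere_def)
  then show False by simp
qed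

text \<open>Away from 0 this chart is inversion, which is continuous; near 0 it covers the outside
  of a large disc. It lets open boxes in coordinates be carried to the sphere.\<close>

lemma open_param_infty_image:
  assumes W: "open W"
  shows "open (param_infty ` W)"
proof -
  let ?V = "Fin -` (param_infty ` W)"
  \<comment> \<open>Removing 0 is essential: \<open>inverse 0 = 0\<close> in HOL, so
    \<open>0 \<in> W\<close> would wrongly admit \<open>Fin 0\<close>.\<close>
  have V: "?V = (\<lambda>z. inverse z) -` W \<inter> (- {0})"
  proof (intro set_eqI iffI)
    fix z assume "z \<in> ?V"
    then show "z \<in> (\<lambda>z. inverse z) -` W \<inter> (- {0})"
      by (auto simp: param_infty_def divide_inverse split: if_splits)
  next
    fix z assume "z \<in> (\<lambda>z. inverse z) -` W \<inter> (- {0})"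
    then have "inverse z \<in> W" "Fin z = param_infty (inverse z)"
      by (auto simp: param_infty_def divide_inverse)
    then show "z \<in> ?V" by auto
  qed
  have "continuous_on (- {0}) (\<lambda>z :: complex. inverse z)"
    by (intro continuous_intros) auto
  then have op: "open ?V"
    unfolding V using W by (subst Int_commute) (intro continuous_open_preimage, auto)
  have "compact (- ?V)" if "Infty \<in> param_infty ` W"
  proof -
    have "0 \<in> W" using that by (auto simp: param_infty_def split: if_splits)
    then obtain e where e: "e > 0" "ball 0 e \<subseteq> W"
      using W open_contains_ball by blast
    \<comment> \<open>Every z with \<open>norm z > inverse e\<close> has its inverse in the ball of
      radius e, hence in W.\<close>
    have "- ?V \<subseteq> cball 0 (inverse e)"
    proof
      fix z assume z: "z \<in> - ?V"
      show "z \<in> cball 0 (inverse e)"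
      proof (cases "z = 0")
        case False
        then have "inverse z \<notin> ball 0 e" using z e by (auto simp: V)
        then have "e \<le> inverse (norm z)" by (simp add: norm_inverse)
        then have "inverse (inverse (norm z)) \<le> inverse e"
          using e by (intro le_imp_inverse_le)
        then show ?thesis by simp
      qed (use e in simp)
    qed
    then have "bounded (- ?V)" using bounded_subset bounded_cball by blast
    then show ?thesis using op by (simp add: compact_eq_bounded_closed closed_Compl)
  qed
  with op show ?thesis by (simp add: open_riemann_sphere_def)
qed

text \<open>A member of the cover that contains \<open>Infty\<close> leaves only a compact part of
  the plane to be covered.\<close>

lemma compact_riemann_sphere: "compact (UNIV :: riemann_sphere set)"
proof (rule topological_space_class.compactI)
  fix C :: "riemann_sphere set set"
  assume C: "\<forall>U\<in>C. open U" "UNIV \<subseteq> \<Union>C"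
  then obtain U where U: "U \<in> C" "Infty \<in> U" by blast
  then have "compact (- (Fin -` U))" using C by (auto simp: open_riemann_sphere_def)
  moreover have "\<forall>V\<in>C. open (Fin -` V)" using C by (auto simp: open_riemann_sphere_def)
  moreover have "- (Fin -` U) \<subseteq> (\<Union>V\<in>C. Fin -` V)" using C by blast
  ultimately obtain D where D: "D \<subseteq> C" "finite D" "- (Fin -` U) \<subseteq> (\<Union>V\<in>D. Fin -` V)"
    by (metis compactE_image)
  have "x \<in> \<Union>(insert U D)" for x
    using U D(3) by (cases x) auto
  then show "\<exists>C'\<subseteq>C. finite C' \<and> UNIV \<subseteq> \<Union>C'"
    using U D by (intro exI[of _ "insert U D"]) auto
qed

text \<open>Closedness of the discs will make their iterated pre-images Borel; the open set inside
  each will give it positive measure.\<close>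

lemma ex_countable_compact_discs:
  obtains \<K> :: "riemann_sphere set set"
  where "countable \<K>"
    and "\<And>K. K \<in> \<K> \<Longrightarrow> closed K"
    and "\<And>K. K \<in> \<K> \<Longrightarrow> \<exists>B\<subseteq>K. open B \<and> B \<noteq> {}"
    and "\<And>U. open U \<Longrightarrow> U \<noteq> {} \<Longrightarrow> \<exists>K\<in>\<K>. K \<subseteq> U"
proof -
  obtain D :: "complex set" where D: "countable D" "\<And>X. open X \<Longrightarrow> X \<noteq> {} \<Longrightarrow> \<exists>d\<in>D. d \<in> X"
    using countable_dense_setE by metis
  \<comment> \<open>Centres run through a countable dense set. \<open>Suc n\<close> keeps the radius
    positive, whereas \<open>1 / 0 = 0\<close> would give a single point.\<close>
  define \<K> where "\<K> = (\<lambda>(d, n). Fin ` cball d (1 / Suc n)) ` (D \<times> UNIV)"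
  show thesis
  proof
    show "countable \<K>" using D(1) by (auto simp: \<K>_def)
    show "closed K" if "K \<in> \<K>" for K
      using that by (auto simp: \<K>_def intro: closed_Fin_image)
    show "\<exists>B\<subseteq>K. open B \<and> B \<noteq> {}" if K: "K \<in> \<K>" for K
    proof -
      obtain d n where "K = Fin ` cball d (1 / Suc n)" using K by (auto simp: \<K>_def)
      then show ?thesis
        by (intro exI[of _ "Fin ` ball d (1 / Suc n)"])
          (auto intro!: open_Fin_image simp del: of_nat_Suc)
    qed
    show "\<exists>K\<in>\<K>. K \<subseteq> U" if U: "open U" "U \<noteq> {}" for U
    proof -
      have "open (Fin -` U)" using U by (simp add: open_riemann_sphere_def)
      moreover obtain x where "x \<in> Fin -` U"
        using open_nonempty_imp_Fin_vimage_nonempty[OF U] by blast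
      ultimately obtain e where e: "e > 0" "ball x e \<subseteq> Fin -` U"
        using open_contains_ball by blast
      \<comment> \<open>Half of e is spent on moving the centre from x to d, the other half on the
        radius.\<close>
      obtain d where d: "d \<in> D" "d \<in> ball x (e / 2)"
        using D(2)[of "ball x (e / 2)"] e by auto
      obtain n where n: "1 / real (Suc n) < e / 2"
        using nat_approx_posE[of "e / 2"] e by auto
      have "cball d (1 / Suc n) \<subseteq> ball x e"
      proof
        fix y assume "y \<in> cball d (1 / Suc n)"
        then have "dist d y < e / 2" using n by simp
        then show "y \<in> ball x e" using d dist_triangle[of x y d] by simp
      qed
      then have "Fin ` cball d (1 / Suc n) \<subseteq> U" using e by blast
      then show ?thesis using d(1) by (auto simp: \<K>_def)
    qed
  qed
qed

section \<open>Closedness of analytic sets and of pre-images\<close>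

lemma holomorphic2_on_imp_continuous_on: "holomorphic2_on f U \<Longrightarrow> continuous_on U f"
  unfolding holomorphic2_on_def continuous_on_eq_continuous_within
  by (blast intro: has_derivative_continuous)

text \<open>Off S some local equation is non-zero, and by continuity it stays non-zero
  nearby.\<close>

lemma analytic_in_plane2_imp_closed:
  assumes "analytic_in_plane2 S"
  shows "closed S"
  unfolding closed_def
proof (rule topological_space_class.openI)
  fix p assume p: "p \<in> - S"
  obtain U F where U: "open U" "p \<in> U" "\<forall>f\<in>F. holomorphic2_on f U"
    "S \<inter> U = {q \<in> U. \<forall>f\<in>F. f q = 0}"
    using assms unfolding analytic_in_plane2_def by meson
  then obtain f where f: "f \<in> F" "f p \<noteq> 0" using p by blast
  have "continuous_on U f" using U f holomorphic2_on_imp_continuous_on by blast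
  then have "open (U \<inter> f -` (- {0}))"
    using U by (intro continuous_open_preimage) auto
  moreover have "U \<inter> f -` (- {0}) \<subseteq> - S"
    using U(4) f(1) by blast
  ultimately show "\<exists>T. open T \<and> p \<in> T \<and> T \<subseteq> - S"
    using U f by (intro exI[of _ "U \<inter> f -` (- {0})"]) auto
qed

lemma sphere_atlas_open_image:
  "\<phi> \<in> sphere_atlas \<Longrightarrow> open U \<Longrightarrow> open (\<phi> ` U)"
  by (auto simp: sphere_atlas_def open_Fin_image open_param_infty_image)

lemma sphere_atlas_covers: "\<exists>\<phi>\<in>sphere_atlas. \<exists>p. \<phi> p = x"
proof (cases x)
  case Infty
  then have "param_infty 0 = x" by (simp add: param_infty_def)
  then show ?thesis unfolding sphere_atlas_def by blast
qed (auto simp: sphere_atlas_def)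

text \<open>In charts around the two coordinates of a point off A, an open box avoids A; the charts
  are open maps, so its image is a neighbourhood avoiding A.\<close>

lemma analytic_subset_imp_closed:
  assumes A: "analytic_subset A"
  shows "closed A"
  unfolding closed_def
proof (rule topological_space_class.openI)
  fix z assume z: "z \<in> - A"
  obtain \<phi> p \<psi> q where \<phi>: "\<phi> \<in> sphere_atlas" "\<phi> p = fst z"
    and \<psi>: "\<psi> \<in> sphere_atlas" "\<psi> q = snd z"
    using sphere_atlas_covers by metis
  have "open (- (map_prod \<phi> \<psi> -` A))"
    using A \<phi> \<psi> analytic_in_plane2_imp_closed by (auto simp: analytic_subset_def)
  moreover have "(p, q) \<in> - (map_prod \<phi> \<psi> -` A)" using z \<phi> \<psi> by simp
  ultimately obtain P Q where PQ: "open P" "open Q" "(p, q) \<in> P \<times> Q"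
    "P \<times> Q \<subseteq> - (map_prod \<phi> \<psi> -` A)"
    by (rule open_prod_elim)
  have "open (\<phi> ` P \<times> \<psi> ` Q)"
    using \<phi> \<psi> PQ by (intro open_Times sphere_atlas_open_image)
  moreover have "z \<in> \<phi> ` P \<times> \<psi> ` Q"
    using PQ(3) \<phi> \<psi> by (cases z) auto
  moreover have "\<phi> ` P \<times> \<psi> ` Q \<subseteq> - A"
    using PQ(4) by auto
  ultimately show "\<exists>T. open T \<and> z \<in> T \<and> T \<subseteq> - A" by blast
qed

lemma closed_support:
  assumes "holomorphic_correspondence \<Gamma>"
  shows "closed (support \<Gamma>)"
  using assms
  by (auto intro: analytic_subset_imp_closed simp: support_def holomorphic_correspondence_def irreducible_analytic_def)

text \<open>This is the tube lemma: projection along a compact factor is closed.\<close>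

lemma closed_relation_vimage_compact:
  assumes R: "closed R" and K: "compact K"
  shows "closed {x. \<exists>y\<in>K. (x, y) \<in> R}"
  unfolding closed_def
proof (rule topological_space_class.openI)
  fix x assume x: "x \<in> - {x. \<exists>y\<in>K. (x, y) \<in> R}"
  have "\<exists>P Q. open P \<and> open Q \<and> x \<in> P \<and> y \<in> Q \<and> P \<times> Q \<subseteq> - R" if "y \<in> K" for y
  proof -
    have "(x, y) \<in> - R" using x that by blast
    with open_Compl[OF R] obtain P Q where "open P" "open Q" "(x, y) \<in> P \<times> Q" "P \<times> Q \<subseteq> - R"
      by (rule open_prod_elim)
    then show ?thesis by blast
  qed
  then obtain P Q where PQ: "\<And>y. y \<in> K \<Longrightarrow> open (P y) \<and> open (Q y) \<and> x \<in> P y \<and> y \<in> Q y \<and>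
    P y \<times> Q y \<subseteq> - R"
    by metis
  then have "\<And>y. y \<in> K \<Longrightarrow> open (Q y)" "K \<subseteq> (\<Union>y\<in>K. Q y)" by blast+
  then obtain D where D: "D \<subseteq> K" "finite D" "K \<subseteq> (\<Union>y\<in>D. Q y)"
    using compactE_image[OF K] by metis
  \<comment> \<open>Finiteness of D, which comes from compactness of K, keeps this intersection
    open.\<close>
  have "open (\<Inter>y\<in>D. P y)" using D PQ by auto
  moreover have "x \<in> (\<Inter>y\<in>D. P y)" using D PQ by auto
  moreover have "(\<Inter>y\<in>D. P y) \<subseteq> - {x. \<exists>y\<in>K. (x, y) \<in> R}"
  proof (clarsimp)
    fix x' y assume "\<forall>y\<in>D. x' \<in> P y" "y \<in> K" "(x', y) \<in> R"
    moreover obtain d where "d \<in> D" "y \<in> Q d" using D \<open>y \<in> K\<close> by blast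
    ultimately show False using PQ[of d] D by blast
  qed
  ultimately show "\<exists>T. open T \<and> x \<in> T \<and> T \<subseteq> - {x. \<exists>y\<in>K. (x, y) \<in> R}" by blast
qed

lemma closed_corr_preimage:
  assumes "holomorphic_correspondence \<Gamma>" "closed K"
  shows "closed (corr_preimage \<Gamma> K)"
proof -
  have "compact K"
    using compact_Int_closed[OF compact_riemann_sphere assms(2)] by simp
  moreover have "corr_preimage \<Gamma> K = {x. \<exists>y\<in>K. (x, y) \<in> support \<Gamma>}"
    by (auto simp: corr_preimage_def corr_adj_def)
  ultimately show ?thesis
    using closed_relation_vimage_compact[OF closed_support[OF assms(1)]] by simp
qed

section \<open>Orbits and ergodicity\<close>

text \<open>Both sides say that no pair of the support lies in \<open>S \<times> T\<close>.\<close>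

lemma corr_image_disjoint_iff:
  "corr_image \<Gamma> S \<inter> T = {} \<longleftrightarrow> S \<inter> corr_preimage \<Gamma> T = {}"
  by (auto simp: corr_image_def corr_map_def corr_preimage_def corr_adj_def)

lemma corr_image_funpow_disjoint_iff:
  "(corr_image \<Gamma> ^^ i) S \<inter> T = {} \<longleftrightarrow> S \<inter> (corr_preimage \<Gamma> ^^ i) T = {}"
proof (induction i arbitrary: S)
  case (Suc i)
  \<comment> \<open>Peeling off the innermost image changes the starting set, hence the induction
    over arbitrary S; that image then becomes the outermost pre-image of T.\<close>
  have "(corr_image \<Gamma> ^^ Suc i) S = (corr_image \<Gamma> ^^ i) (corr_image \<Gamma> S)"
    by (simp only: funpow_Suc_right o_apply)
  with Suc.IH[of "corr_image \<Gamma> S"] show ?case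
    by (simp only: corr_image_disjoint_iff funpow.simps o_apply)
qed simp

lemma corr_iter_disjoint_iff:
  "corr_iter \<Gamma> i z \<inter> K = {} \<longleftrightarrow> z \<notin> (corr_preimage \<Gamma> ^^ i) K"
  by (simp add: corr_iter_def corr_image_funpow_disjoint_iff)

lemma ergodic_AE_orbit_meets_closed:
  assumes \<Gamma>: "holomorphic_correspondence \<Gamma>"
    and \<mu>: "\<mu> \<in> borel_prob_measures"
    and erg: "ergodic \<Gamma> \<mu>"
    and K: "closed K" "measure \<mu> K > 0"
  shows "AE z in \<mu>. (\<Union>i. corr_iter \<Gamma> i z) \<inter> K \<noteq> {}"
proof -
  interpret prob_space \<mu> using \<mu> by (simp add: borel_prob_measures_def)
  have sets: "sets \<mu> = sets borel" using \<mu> by (simp add: borel_prob_measures_def)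
  define A where "A = (\<Union>i. (corr_preimage \<Gamma> ^^ i) K)"
  have "closed ((corr_preimage \<Gamma> ^^ i) K)" for i
    by (induction i) (simp_all add: K \<Gamma> closed_corr_preimage)
  then have A: "A \<in> sets borel" by (auto simp: A_def)
  \<comment> \<open>Pre-images commute with unions, so the index just shifts by one. The next
    inclusion makes A its own witness \<open>A'\<close> for almost invariance.\<close>
  have "corr_preimage \<Gamma> A = (\<Union>i. (corr_preimage \<Gamma> ^^ Suc i) K)"
    by (auto simp: A_def corr_preimage_def)
  then have "corr_preimage \<Gamma> A \<subseteq> A" unfolding A_def by blast
  with A have "almost_invariant \<Gamma> \<mu> A" unfolding almost_invariant_def by blast
  with erg have "measure \<mu> A = 0 \<or> measure \<mu> A = 1" by (auto simp: ergodic_def)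
  moreover have "(corr_preimage \<Gamma> ^^ 0) K \<subseteq> A" unfolding A_def by blast
  then have "measure \<mu> K \<le> measure \<mu> A"
    using A sets by (intro finite_measure_mono) auto
  ultimately have "measure \<mu> A = 1" using K by simp
  then have "AE z in \<mu>. z \<in> A" using A sets by (subst prob_eq_1[symmetric]) auto
  moreover have "(\<Union>i. corr_iter \<Gamma> i z) \<inter> K \<noteq> {}" if "z \<in> A" for z
  proof -
    from that obtain i where "z \<in> (corr_preimage \<Gamma> ^^ i) K" unfolding A_def by blast
    then have "corr_iter \<Gamma> i z \<inter> K \<noteq> {}" by (simp only: corr_iter_disjoint_iff not_not)
    then show ?thesis by blast
  qed
  ultimately show ?thesis by (auto elim: eventually_mono)
qed

theorem theorem5p5:
  fixes \<Gamma> :: correspondence and \<mu> :: "riemann_sphere measure"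
  assumes "holomorphic_correspondence \<Gamma>"
    and "\<mu> \<in> borel_prob_measures"
    and "ergodic \<Gamma> \<mu>"
    and "\<And>B. open B \<Longrightarrow> B \<noteq> {} \<Longrightarrow> measure \<mu> B > 0"
  shows "AE z in \<mu>. closure (\<Union>i. corr_iter \<Gamma> i z) = UNIV"
proof -
  interpret prob_space \<mu> using assms(2) by (simp add: borel_prob_measures_def)
  have sets: "sets \<mu> = sets borel" using assms(2) by (simp add: borel_prob_measures_def)
  obtain \<K> :: "riemann_sphere set set" where \<K>: "countable \<K>" "\<And>K. K \<in> \<K> \<Longrightarrow> closed K"
    "\<And>K. K \<in> \<K> \<Longrightarrow> \<exists>B\<subseteq>K. open B \<and> B \<noteq> {}"
    "\<And>U. open U \<Longrightarrow> U \<noteq> {} \<Longrightarrow> \<exists>K\<in>\<K>. K \<subseteq> U"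
    using ex_countable_compact_discs by metis
  have "AE z in \<mu>. (\<Union>i. corr_iter \<Gamma> i z) \<inter> K \<noteq> {}" if "K \<in> \<K>" for K
  proof -
    from \<K>(3)[OF that] obtain B where B: "B \<subseteq> K" "open B" "B \<noteq> {}" by blast
    \<comment> \<open>Positivity is assumed for open sets only, so it reaches the closed disc K
      through B.\<close>
    have "0 < measure \<mu> B" using assms(4) B by blast
    also have "\<dots> \<le> measure \<mu> K"
      using B \<K>(2)[OF that] sets by (intro finite_measure_mono) auto
    finally show ?thesis
      using ergodic_AE_orbit_meets_closed assms \<K>(2)[OF that] by blast
  qed
  \<comment> \<open>Countability of the family puts all exceptional points into one null
    set.\<close>
  then have "AE z in \<mu>. \<forall>K\<in>\<K>. (\<Union>i. corr_iter \<Gamma> i z) \<inter> K \<noteq> {}"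
    using \<K>(1) by (simp add: AE_ball_countable)
  moreover have "closure O' = UNIV" if "\<forall>K\<in>\<K>. O' \<inter> K \<noteq> {}" for O' :: "riemann_sphere set"
  proof (rule ccontr)
    assume "closure O' \<noteq> UNIV"
    then obtain K where "K \<in> \<K>" "K \<subseteq> - closure O'"
      using \<K>(4)[of "- closure O'"] by auto
    then show False using that closure_subset[of O'] by blast
  qed
  ultimately show ?thesis by (auto elim!: eventually_mono)
qed

end
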